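(* Let $n\ge 1$, let $f_i:\mathbb{R}^d\to\mathbb{R}$ be convex and $L_i$-smooth with $L_i>0$ for $i=1,\dots,n$, and let $\psi:\mathbb{R}^d\to\mathbb{R}\cup\{+\infty\}$ be proper, closed and $\mu$-strongly convex with $\mu>0$. Let $L_{\max}=\max_i L_i$ and let $x_\ast$ be the minimizer of $P(x)=\frac1n\sum_{i=1}^n f_i(x)+\psi(x)$. If ProxRR or ProxSO is run from $x_0\in\mathbb{R}^d$ with constant stepsize $\gamma_t=\gamma$, where $0<\gamma\le\frac1{L_{\max}}$, then for every number of epochs $T\ge 0$ the iterates satisfy $$\mathbb{E}\|x_T-x_\ast\|^2\le(1+2\gamma\mu n)^{-T}\|x_0-x_\ast\|^2+\frac{\gamma^2\sigma_{\mathrm{rad}}^2}{\mu},$$ where $\sigma_{\mathrm{rad}}^2=\sigma_{\mathrm{rad}}^2(\gamma)$ is the shuffling radius.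
   Context: A differentiable function $\phi:\mathbb{R}^d\to\mathbb{R}$ has Bregman divergence $D_\phi(x,y)=\phi(x)-\phi(y)-\langle\nabla\phi(y),x-y\rangle$; it is $L$-smooth if it is continuously differentiable and $D_\phi(x,y)\le\frac L2\|x-y\|^2$ for all $x,y$. An extended-real-valued function $\psi$ is $\mu$-strongly convex if $\psi-\frac\mu2\|\cdot\|^2$ is convex. Proximal operator: $\mathrm{prox}_{\eta\psi}(x)=\arg\min_{z}\{\eta\psi(z)+\frac12\|z-x\|^2\}$. Algorithm (ProxRR / ProxSO), with stepsizes $\gamma_t>0$: for each epoch $t=0,1,\dots,T-1$, take a permutation $\pi=(\pi_0,\dots,\pi_{n-1})$ of $\{1,\dots,n\}$; set $x_t^0=x_t$; for $i=0,\dots,n-1$ set $x_t^{i+1}=x_t^i-\gamma_t\nabla f_{\pi_i}(x_t^i)$; then set $x_{t+1}=\mathrm{prox}_{\gamma_t n\psi}(x_t^n)$. In ProxRR a fresh uniformly random permutation is sampled independently at every epoch; in ProxSO a single uniformly random permutation is sampled once at the start and used in all epochs. Shuffling radius: for $\gamma>0$ and a permutation $\pi$, let $x_\ast^i=x_\ast-\gamma\sum_{j=0}^{i-1}\nabla f_{\pi_j}(x_\ast)$ for $i=1,\dots,n-1$, and $$\sigma_{\mathrm{rad}}^2(\gamma)=\max_{i=1,\dots,n-1}\frac1{\gamma^2}\mathbb{E}_\pi\bigl[D_{f_{\pi_i}}(x_\ast^i,x_\ast)\bigr],$$ with expectation over a uniformly random permutation $\pi$ (a maximum over the empty set, when $n=1$,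 is $0$). *)

theory Defs
  imports "HOL-Probability.Probability" "HOL-Combinatorics.Multiset_Permutations"
begin

section \<open>Smooth functions and Bregman divergence\<close>

definition gradient :: "('a::real_inner \<Rightarrow> real) \<Rightarrow> 'a \<Rightarrow> 'a" where
  "gradient f x = (THE D. GDERIV f x :> D)"

definition bregman :: "('a::real_inner \<Rightarrow> real) \<Rightarrow> 'a \<Rightarrow> 'a \<Rightarrow> real" where
  "bregman f x y = f x - f y - gradient f y \<bullet> (x - y)"

definition L_smooth :: "real \<Rightarrow> ('a::real_inner \<Rightarrow> real) \<Rightarrow> bool" where
  "L_smooth L f \<longleftrightarrow>
     (\<forall>x. f differentiable (at x)) \<and>
     continuous_on UNIV (gradient f) \<and>
     (\<forall>x y. bregman f x y \<le> L / 2 * (norm (x - y))\<^sup>2)"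

section \<open>Extended-real-valued functions\<close>

text \<open>
  The library notions \<^const>\<open>epigraph\<close> and \<^const>\<open>convex_on\<close> are for real-valued functions only.
  Convexity and closedness of an extended-real-valued function are those of its epigraph,
  a subset of the product of the domain with the finite reals.
\<close>

definition ereal_epigraph :: "('a \<Rightarrow> ereal) \<Rightarrow> ('a \<times> real) set" where
  "ereal_epigraph \<psi> = {(x, r). \<psi> x \<le> ereal r}"

definition proper_fun :: "('a \<Rightarrow> ereal) \<Rightarrow> bool" where
  "proper_fun \<psi> \<longleftrightarrow> (\<forall>x. \<psi> x \<noteq> -\<infinity>) \<and> (\<exists>x. \<psi> x \<noteq> \<infinity>)"

definition closed_fun :: "('a::real_normed_vector \<Rightarrow> ereal) \<Rightarrow> bool" where
  "closed_fun \<psi> \<longleftrightarrow> closed (ereal_epigraph \<psi>)"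

definition convex_fun :: "('a::real_vector \<Rightarrow> ereal) \<Rightarrow> bool" where
  "convex_fun \<psi> \<longleftrightarrow> convex (ereal_epigraph \<psi>)"

definition strongly_convex :: "real \<Rightarrow> ('a::real_normed_vector \<Rightarrow> ereal) \<Rightarrow> bool" where
  "strongly_convex \<mu> \<psi> \<longleftrightarrow> convex_fun (\<lambda>x. \<psi> x - ereal (\<mu> / 2 * (norm x)\<^sup>2))"

text \<open>
  If \<open>\<psi>\<close> is proper, closed and convex and \<open>\<eta> > 0\<close>, the minimizer below exists and is
  unique, so the choice made by \<^const>\<open>arg_min\<close> is immaterial.
\<close>

definition prox :: "real \<Rightarrow> ('a::real_normed_vector \<Rightarrow> ereal) \<Rightarrow> 'a \<Rightarrow> 'a" where
  "prox \<eta> \<psi> x =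
     arg_min (\<lambda>z. ereal \<eta> * \<psi> z + ereal (1 / 2 * (norm (z - x))\<^sup>2)) (\<lambda>_. True)"

definition composite_objective ::
  "nat \<Rightarrow> (nat \<Rightarrow> 'a \<Rightarrow> real) \<Rightarrow> ('a \<Rightarrow> ereal) \<Rightarrow> 'a \<Rightarrow> ereal" where
  "composite_objective n f \<psi> x = ereal (1 / real n * (\<Sum>i=1..n. f i x)) + \<psi> x"

section \<open>Shuffling algorithms\<close>

text \<open>
  A permutation of \<open>{1..n}\<close> is a list \<open>p\<close> enumerating this set without repetition;
  its entries \<open>p ! 0, \<dots>, p ! (n - 1)\<close> are \<open>\<pi>\<^sub>0, \<dots>, \<pi>\<^sub>n\<^sub>-\<^sub>1\<close>.
\<close>

definition random_perm :: "nat \<Rightarrow> nat list pmf" where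
  "random_perm n = pmf_of_set (permutations_of_set {1..n})"

primrec inner_iterate ::
  "real \<Rightarrow> (nat \<Rightarrow> 'a::real_inner \<Rightarrow> real) \<Rightarrow> nat list \<Rightarrow> 'a \<Rightarrow> nat \<Rightarrow> 'a" where
  "inner_iterate \<gamma> f p x 0 = x"
| "inner_iterate \<gamma> f p x (Suc i) =
     inner_iterate \<gamma> f p x i - \<gamma> *\<^sub>R gradient (f (p ! i)) (inner_iterate \<gamma> f p x i)"

text \<open>Epoch \<open>t\<close> uses the stepsize \<open>\<gamma> t\<close> and the permutation \<open>\<pi> t\<close>.\<close>

primrec shuffled_prox_iterate ::
  "(nat \<Rightarrow> real) \<Rightarrow> nat \<Rightarrow> (nat \<Rightarrow> 'a::real_inner \<Rightarrow> real) \<Rightarrow> ('a \<Rightarrow> ereal) \<Rightarrow>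
   (nat \<Rightarrow> nat list) \<Rightarrow> 'a \<Rightarrow> nat \<Rightarrow> 'a" where
  "shuffled_prox_iterate \<gamma> n f \<psi> \<pi> x\<^sub>0 0 = x\<^sub>0"
| "shuffled_prox_iterate \<gamma> n f \<psi> \<pi> x\<^sub>0 (Suc t) =
     prox (\<gamma> t * real n) \<psi>
       (inner_iterate (\<gamma> t) f (\<pi> t) (shuffled_prox_iterate \<gamma> n f \<psi> \<pi> x\<^sub>0 t) n)"

text \<open>
  Distributions of the iterate after \<open>T\<close> epochs. Under \<^const>\<open>Pi_pmf\<close> the permutations of
  epochs \<open>0, \<dots>, T - 1\<close> are independent and uniform; the default value \<open>[]\<close> for later
  epochs is never read.
\<close>

definition prox_rr ::
  "(nat \<Rightarrow> real) \<Rightarrow> nat \<Rightarrow> (nat \<Rightarrow> 'a::real_inner \<Rightarrow> real) \<Rightarrow> ('a \<Rightarrow> ereal) \<Rightarrow> 'a \<Rightarrow> nat \<Rightarrow> 'a pmf" where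
  "prox_rr \<gamma> n f \<psi> x\<^sub>0 T =
     map_pmf (\<lambda>\<pi>. shuffled_prox_iterate \<gamma> n f \<psi> \<pi> x\<^sub>0 T) (Pi_pmf {..<T} [] (\<lambda>_. random_perm n))"

definition prox_so ::
  "(nat \<Rightarrow> real) \<Rightarrow> nat \<Rightarrow> (nat \<Rightarrow> 'a::real_inner \<Rightarrow> real) \<Rightarrow> ('a \<Rightarrow> ereal) \<Rightarrow> 'a \<Rightarrow> nat \<Rightarrow> 'a pmf" where
  "prox_so \<gamma> n f \<psi> x\<^sub>0 T =
     map_pmf (\<lambda>p. shuffled_prox_iterate \<gamma> n f \<psi> (\<lambda>_. p) x\<^sub>0 T) (random_perm n)"

section \<open>Shuffling radius\<close>

definition star_iterate ::
  "real \<Rightarrow> (nat \<Rightarrow> 'a::real_inner \<Rightarrow> real) \<Rightarrow> nat list \<Rightarrow> 'a \<Rightarrow> nat \<Rightarrow> 'a" where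
  "star_iterate \<gamma> f p x\<^sub>s i = x\<^sub>s - \<gamma> *\<^sub>R (\<Sum>j<i. gradient (f (p ! j)) x\<^sub>s)"

definition shuffling_radius_sq ::
  "nat \<Rightarrow> (nat \<Rightarrow> 'a::real_inner \<Rightarrow> real) \<Rightarrow> 'a \<Rightarrow> real \<Rightarrow> real" where
  "shuffling_radius_sq n f x\<^sub>s \<gamma> =
     (if n \<le> 1 then 0
      else Max ((\<lambda>i. 1 / \<gamma>\<^sup>2 *
             measure_pmf.expectation (random_perm n)
               (\<lambda>p. bregman (f (p ! i)) (star_iterate \<gamma> f p x\<^sub>s i) x\<^sub>s)) ` {1..n - 1}))"

end

theory Submission
  imports Defs
begin

text \<open>
  The inner iterates are compared with the points \<open>star_iterate \<gamma> f p x\<^sub>s i\<close>, which follow the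
  gradients frozen at \<open>x\<^sub>s\<close>. The three-point identity of the Bregman divergence and
  cocoercivity of the gradients give, for \<open>\<gamma> \<le> 1 / L\<close>, that one gradient step increases the
  squared distance to the reference point by at most \<open>2 * \<gamma> * bregman (f (p ! i)) (star_iterate \<gamma> f p x\<^sub>s i) x\<^sub>s\<close>.
  The last reference point does not depend on the permutation and is mapped to \<open>x\<^sub>s\<close> by the
  proximal step, a contraction of the squared distance by the factor \<open>1 / (1 + 2 * \<gamma> * \<mu> * n)\<close>.
  The error of an epoch is a function of its permutation alone. So in expectation only the
  marginal law of each epoch's permutation matters, which is uniform both for independent
  reshuffling and for a single shuffle.
\<close>

section \<open>Gradients and first-order optimality\<close>

text \<open>The definite description in \<open>gradient\<close> needs uniqueness: the difference of
  two candidates is orthogonal to every vector, hence to itself.\<close>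

lemma gradient_eq:
  assumes "GDERIV f x :> D"
  shows "gradient f x = D"
proof -
  have "E = D" if "GDERIV f x :> E" for E
  proof -
    have "(\<lambda>h. h \<bullet> E) = (\<lambda>h. h \<bullet> D)"
      using has_derivative_unique that assms unfolding gderiv_def by blast
    then have "(E - D) \<bullet> E = (E - D) \<bullet> D"
      by (rule fun_cong)
    then have "(E - D) \<bullet> (E - D) = 0"
      by (simp only: inner_diff_right)
    then show ?thesis
      by simp
  qed
  with assms show ?thesis
    unfolding gradient_def by blast
qed

text \<open>In finite dimension the derivative is represented by the vector of its values on the
  basis.\<close>

lemma gderiv_gradient:
  fixes f :: "'a::euclidean_space \<Rightarrow> real"
  assumes "f differentiable (at x)"
  shows "GDERIV f x :> gradient f x"
proof -
  obtain F where F: "(f has_derivative F) (at x)"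
    using assms unfolding differentiable_def by blast
  interpret bounded_linear F
    using F by (rule has_derivative_bounded_linear)
  have "F = (\<lambda>h. h \<bullet> (\<Sum>b\<in>Basis. F b *\<^sub>R b))"
  proof
    fix h
    have "F h = F (\<Sum>b\<in>Basis. (h \<bullet> b) *\<^sub>R b)"
      by (simp add: euclidean_representation)
    then show "F h = h \<bullet> (\<Sum>b\<in>Basis. F b *\<^sub>R b)"
      by (simp add: sum scaleR inner_sum_right mult.commute)
  qed
  with F have "GDERIV f x :> (\<Sum>b\<in>Basis. F b *\<^sub>R b)"
    unfolding gderiv_def by simp
  with gradient_eq show ?thesis
    by metis
qed

text \<open>Minimality of \<open>g + h\<close> at \<open>x\<close> along the segment to
  \<open>w\<close> is combined with the convexity inequality for \<open>h\<close>, divided by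
  \<open>s\<close>, and \<open>s\<close> tends to 0 from the right: the difference quotient of
  \<open>g\<close> becomes \<open>G \<bullet> (w - x)\<close> and the factor \<open>1 - s\<close>
  becomes 1. Taking \<open>\<mu> = 0\<close> covers plain convexity.\<close>

lemma argmin_quadratic_growth:
  fixes g h :: "'a::real_inner \<Rightarrow> real"
  assumes g: "GDERIV g x :> G"
    and h: "\<And>s. 0 < s \<Longrightarrow> s < 1 \<Longrightarrow> h (x + s *\<^sub>R (w - x))
      \<le> (1 - s) * h x + s * h w - \<mu> / 2 * (s * (1 - s)) * (norm (w - x))\<^sup>2"
    and min: "\<And>s. 0 < s \<Longrightarrow> s < 1 \<Longrightarrow>
      g x + h x \<le> g (x + s *\<^sub>R (w - x)) + h (x + s *\<^sub>R (w - x))"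
  shows "h x + \<mu> / 2 * (norm (w - x))\<^sup>2 \<le> h w + G \<bullet> (w - x)"
proof -
  define q where "q s = g (x + s *\<^sub>R (w - x))" for s :: real
  have "(q has_derivative (\<lambda>s. (s *\<^sub>R (w - x)) \<bullet> G)) (at 0)"
  proof -
    have "((\<lambda>s. x + s *\<^sub>R (w - x)) has_derivative (\<lambda>s. s *\<^sub>R (w - x))) (at 0)"
      by (auto intro!: derivative_eq_intros)
    moreover have "(g has_derivative (\<lambda>h. h \<bullet> G)) (at (x + 0 *\<^sub>R (w - x)))"
      using g unfolding gderiv_def by simp
    ultimately show ?thesis
      unfolding q_def by (rule has_derivative_compose)
  qed
  moreover have "(\<lambda>s. (s *\<^sub>R (w - x)) \<bullet> G) = (*) (G \<bullet> (w - x))"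
    by (rule ext) (simp add: inner_commute[of G])
  ultimately have "(q has_real_derivative (G \<bullet> (w - x))) (at 0)"
    unfolding has_field_derivative_def by simp
  then have lim: "((\<lambda>s. (q s - q 0) / s) \<longlongrightarrow> G \<bullet> (w - x)) (at_right 0)"
    unfolding has_field_derivative_iff using filterlim_at_split by force
  have "((\<lambda>s. h w + (q s - q 0) / s - \<mu> / 2 * (1 - s) * (norm (w - x))\<^sup>2) \<longlongrightarrow>
      h w + G \<bullet> (w - x) - \<mu> / 2 * (1 - 0) * (norm (w - x))\<^sup>2) (at_right 0)"
    by (intro tendsto_intros lim)
  moreover have "\<forall>\<^sub>F s in at_right 0. h x \<le> h w + (q s - q 0) / s - \<mu> / 2 * (1 - s) * (norm (w - x))\<^sup>2"
  proof -
    have "h x \<le> h w + (q s - q 0) / s - \<mu> / 2 * (1 - s) * (norm (w - x))\<^sup>2" if s: "0 < s" "s < 1" for s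
    proof -
      have "s * h x \<le> s * h w + (q s - q 0) - \<mu> / 2 * (s * (1 - s)) * (norm (w - x))\<^sup>2"
        using h[OF s] min[OF s] by (simp add: q_def algebra_simps)
      also have "\<dots> = s * (h w + (q s - q 0) / s - \<mu> / 2 * (1 - s) * (norm (w - x))\<^sup>2)"
        using s by (simp add: field_simps)
      finally show ?thesis
        using s by simp
    qed
    then show ?thesis
      unfolding eventually_at_right_field by (intro exI[of _ 1]) auto
  qed
  ultimately have "h x \<le> h w + G \<bullet> (w - x) - \<mu> / 2 * (1 - 0) * (norm (w - x))\<^sup>2"
    by (intro tendsto_lowerbound) auto
  then show ?thesis
    by simp
qed

section \<open>Bregman divergences of convex smooth functions\<close>

lemma bregman_nonneg:
  fixes f :: "'a::euclidean_space \<Rightarrow> real"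
  assumes "convex_on UNIV f" and "f differentiable (at y)"
  shows "0 \<le> bregman f x y"
proof -
  \<comment> \<open>\<open>y\<close> minimizes the zero function \<open>- f + f\<close>.\<close>
  have "f y + 0 / 2 * (norm (x - y))\<^sup>2 \<le> f x + (- gradient f y) \<bullet> (x - y)"
  proof (rule argmin_quadratic_growth)
    show "GDERIV (\<lambda>z. - f z) y :> - gradient f y"
      by (intro GDERIV_minus gderiv_gradient assms)
    fix s :: real assume "0 < s" "s < 1"
    then have "f ((1 - s) *\<^sub>R y + s *\<^sub>R x) \<le> (1 - s) * f y + s * f x"
      using assms(1) by (intro convex_onD) auto
    then show "f (y + s *\<^sub>R (x - y)) \<le> (1 - s) * f y + s * f x - 0 / 2 * (s * (1 - s)) * (norm (x - y))\<^sup>2"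
      by (simp add: algebra_simps)
  qed simp
  then show ?thesis
    by (simp add: bregman_def)
qed

text \<open>Serves to expand a divergence around the base point of a gradient step, and to turn the
  cross term of a squared distance into divergences.\<close>

lemma bregman_three_point:
  "bregman f z y = bregman f z x + bregman f x y + (gradient f x - gradient f y) \<bullet> (z - x)"
  by (simp add: bregman_def algebra_simps)

lemma gradient_cocoercive:
  fixes f :: "'a::euclidean_space \<Rightarrow> real"
  assumes "convex_on UNIV f" and f: "L_smooth L f" and "L > 0"
  shows "(norm (gradient f x - gradient f y))\<^sup>2 \<le> 2 * L * bregman f x y"
proof -
  define d where "d = gradient f x - gradient f y"
  \<comment> \<open>One gradient step from \<open>x\<close> for the function \<open>bregman f \<cdot> y\<close>, which is minimal at \<open>y\<close>.\<close>
  define z where "z = x - (1 / L) *\<^sub>R d"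
  have "0 \<le> bregman f z y"
    using assms by (intro bregman_nonneg) (auto simp: L_smooth_def)
  also have "\<dots> = bregman f z x + bregman f x y + d \<bullet> (z - x)"
    unfolding d_def by (rule bregman_three_point)
  also have "\<dots> \<le> L / 2 * (norm (z - x))\<^sup>2 + bregman f x y + d \<bullet> (z - x)"
    using f by (simp add: L_smooth_def)
  \<comment> \<open>The step length \<open>1 / L\<close> minimizes the quadratic upper bound along
    \<open>d\<close>, which yields the decrease \<open>(norm d)\<^sup>2 / (2 * L)\<close>.\<close>
  also have "\<dots> = bregman f x y - (norm d)\<^sup>2 / (2 * L)"
    using \<open>L > 0\<close>
    by (simp add: z_def power_mult_distrib power_divide dot_square_norm field_simps power2_eq_square)
  finally show ?thesis
    using \<open>L > 0\<close> by (simp add: d_def field_simps)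
qed

section \<open>Distance to the reference points within an epoch\<close>

text \<open>The point \<open>z\<close> moves along the gradient frozen at \<open>y\<close>. When the
  square is expanded, the cross term contributes the divergences of \<open>(z, y)\<close>,
  \<open>(z, x)\<close> and \<open>(x, y)\<close>, the last two with a negative sign. The one of
  \<open>(x, y)\<close> absorbs the squared gradient difference by cocoercivity, and the one of
  \<open>(z, x)\<close> is dropped.\<close>

lemma gradient_step_norm_le:
  fixes f :: "'a::euclidean_space \<Rightarrow> real"
  assumes f: "convex_on UNIV f" "L_smooth L f" "L > 0" and \<gamma>: "0 < \<gamma>" "\<gamma> * L \<le> 1"
  shows "(norm ((x - \<gamma> *\<^sub>R gradient f x) - (z - \<gamma> *\<^sub>R gradient f y)))\<^sup>2
    \<le> (norm (x - z))\<^sup>2 + 2 * \<gamma> * bregman f z y"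
proof -
  define d where "d = gradient f x - gradient f y"
  have diff: "f differentiable (at u)" for u
    using f by (simp add: L_smooth_def)
  have nonneg: "0 \<le> bregman f x y" "0 \<le> bregman f z x"
    using f diff by (auto intro: bregman_nonneg)
  have "(\<gamma> * norm d)\<^sup>2 \<le> \<gamma>\<^sup>2 * (2 * L * bregman f x y)"
    using gradient_cocoercive[OF f, of x y] \<gamma>
    by (simp add: d_def power_mult_distrib mult_left_mono)
  also have "\<dots> = (\<gamma> * L) * (2 * \<gamma> * bregman f x y)"
    by (simp add: power2_eq_square)
  also have "\<dots> \<le> 1 * (2 * \<gamma> * bregman f x y)"
    using \<gamma> nonneg by (intro mult_right_mono) auto
  finally have sq: "(\<gamma> * norm d)\<^sup>2 \<le> 2 * \<gamma> * bregman f x y"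
    by simp
  have "(norm ((x - \<gamma> *\<^sub>R gradient f x) - (z - \<gamma> *\<^sub>R gradient f y)))\<^sup>2 = (norm ((x - z) - \<gamma> *\<^sub>R d))\<^sup>2"
    by (simp add: d_def algebra_simps)
  also have "\<dots> = (norm (x - z))\<^sup>2 + 2 * \<gamma> * (d \<bullet> (z - x)) + (\<gamma> * norm d)\<^sup>2"
    unfolding power_mult_distrib power2_norm_eq_inner
    by (simp add: algebra_simps inner_commute power2_eq_square)
  also have "d \<bullet> (z - x) = bregman f z y - bregman f z x - bregman f x y"
    using bregman_three_point[of f z y x] by (simp add: d_def)
  also have "(norm (x - z))\<^sup>2 + 2 * \<gamma> * (bregman f z y - bregman f z x - bregman f x y) + (\<gamma> * norm d)\<^sup>2
      \<le> (norm (x - z))\<^sup>2 + 2 * \<gamma> * bregman f z y - 2 * \<gamma> * bregman f z x"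
    using sq by (simp add: algebra_simps)
  also have "\<dots> \<le> (norm (x - z))\<^sup>2 + 2 * \<gamma> * bregman f z y"
    using \<gamma> nonneg by simp
  finally show ?thesis .
qed

text \<open>The one-step bound is summed with \<open>z\<close> the current reference point and
  \<open>y = x\<^sub>s\<close>. Restricting the hypotheses to positions below \<open>i\<close> keeps
  the induction within the entries already visited.\<close>

lemma inner_iterate_norm_le:
  fixes f :: "nat \<Rightarrow> 'a::euclidean_space \<Rightarrow> real"
  assumes "\<And>j. j < i \<Longrightarrow> convex_on UNIV (f (p ! j))"
    and "\<And>j. j < i \<Longrightarrow> L_smooth (L (p ! j)) (f (p ! j))"
    and "\<And>j. j < i \<Longrightarrow> L (p ! j) > 0"
    and "\<And>j. j < i \<Longrightarrow> \<gamma> * L (p ! j) \<le> 1"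
    and "0 < \<gamma>"
  shows "(norm (inner_iterate \<gamma> f p x i - star_iterate \<gamma> f p x\<^sub>s i))\<^sup>2
    \<le> (norm (x - x\<^sub>s))\<^sup>2 + 2 * \<gamma> * (\<Sum>j<i. bregman (f (p ! j)) (star_iterate \<gamma> f p x\<^sub>s j) x\<^sub>s)"
  using assms
proof (induction i)
  case 0
  then show ?case
    by (simp add: star_iterate_def)
next
  case (Suc i)
  have "star_iterate \<gamma> f p x\<^sub>s (Suc i) = star_iterate \<gamma> f p x\<^sub>s i - \<gamma> *\<^sub>R gradient (f (p ! i)) x\<^sub>s"
    by (simp add: star_iterate_def algebra_simps)
  then have "(norm (inner_iterate \<gamma> f p x (Suc i) - star_iterate \<gamma> f p x\<^sub>s (Suc i)))\<^sup>2
      \<le> (norm (inner_iterate \<gamma> f p x i - star_iterate \<gamma> f p x\<^sub>s i))\<^sup>2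
        + 2 * \<gamma> * bregman (f (p ! i)) (star_iterate \<gamma> f p x\<^sub>s i) x\<^sub>s"
    using gradient_step_norm_le[of "f (p ! i)" "L (p ! i)" \<gamma>] Suc.prems by simp
  with Suc show ?case
    by (simp add: distrib_left)
qed

section \<open>Strong convexity of extended-real-valued functions\<close>

text \<open>Two points of the epigraph of \<open>\<psi>\<close> minus the quadratic are combined,
  and the quadratic is added back at \<open>z\<close>. The exact formula \<open>norm_z\<close> for
  the squared norm of a convex combination leaves the term in \<open>s * (1 - s)\<close>.\<close>

lemma strongly_convex_segment:
  fixes \<psi> :: "'a::real_inner \<Rightarrow> ereal"
  assumes sc: "strongly_convex \<mu> \<psi>" and x: "\<psi> x = ereal a" and w: "\<psi> w = ereal b"
    and s: "0 < s" "s < 1"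
  shows "\<psi> (x + s *\<^sub>R (w - x)) \<le> ereal ((1 - s) * a + s * b - \<mu> / 2 * (s * (1 - s)) * (norm (w - x))\<^sup>2)"
proof -
  define z where "z = x + s *\<^sub>R (w - x)"
  define E where "E = ereal_epigraph (\<lambda>x. \<psi> x - ereal (\<mu> / 2 * (norm x)\<^sup>2))"
  define r where "r = (1 - s) * (a - \<mu> / 2 * (norm x)\<^sup>2) + s * (b - \<mu> / 2 * (norm w)\<^sup>2)"
  have "convex E"
    using sc by (simp add: strongly_convex_def convex_fun_def E_def)
  moreover have "(x, a - \<mu> / 2 * (norm x)\<^sup>2) \<in> E" "(w, b - \<mu> / 2 * (norm w)\<^sup>2) \<in> E"
    using x w by (simp_all add: E_def ereal_epigraph_def)
  ultimately have "(1 - s) *\<^sub>R (x, a - \<mu> / 2 * (norm x)\<^sup>2) + s *\<^sub>R (w, b - \<mu> / 2 * (norm w)\<^sup>2) \<in> E"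
    using s by (intro convexD) auto
  also have "(1 - s) *\<^sub>R (x, a - \<mu> / 2 * (norm x)\<^sup>2) + s *\<^sub>R (w, b - \<mu> / 2 * (norm w)\<^sup>2) = (z, r)"
    by (simp add: r_def z_def algebra_simps)
  finally have "\<psi> z - ereal (\<mu> / 2 * (norm z)\<^sup>2) \<le> ereal r"
    by (simp add: E_def ereal_epigraph_def)
  then have "\<psi> z \<le> ereal (r + \<mu> / 2 * (norm z)\<^sup>2)"
    by (cases "\<psi> z") auto
  moreover have norm_z: "(norm z)\<^sup>2 = (1 - s) * (norm x)\<^sup>2 + s * (norm w)\<^sup>2 - (s * (1 - s)) * (norm (w - x))\<^sup>2"
    unfolding z_def power2_norm_eq_inner
    by (simp add: algebra_simps inner_commute power2_eq_square)
  moreover have "r + \<mu> / 2 * (norm z)\<^sup>2 = (1 - s) * a + s * b - \<mu> / 2 * (s * (1 - s)) * (norm (w - x))\<^sup>2"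
  proof -
    have "(1 - s) * (a - m * X) + s * (b - m * W) + m * ((1 - s) * X + s * W - k) = (1 - s) * a + s * b - m * k"
      for m k X W :: real
      by (simp add: algebra_simps)
    then show ?thesis
      by (simp only: norm_z r_def mult.assoc)
  qed
  ultimately show ?thesis
    by (simp add: z_def)
qed

text \<open>Between two points of finite value \<open>\<psi>\<close> stays finite, so its real part
  meets the hypotheses of \<open>argmin_quadratic_growth\<close>. Applied both to the minimizer
  \<open>x\<^sub>s\<close> of the objective and to the output of the proximal step.\<close>

lemma strongly_convex_argmin_growth:
  fixes \<psi> :: "'a::real_inner \<Rightarrow> ereal"
  assumes "strongly_convex \<mu> \<psi>" and "\<And>z. \<psi> z \<noteq> -\<infinity>" and g: "GDERIV g x :> G"
    and x: "\<psi> x = ereal a" and w: "\<psi> w = ereal b"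
    and min: "\<And>z c. \<psi> z = ereal c \<Longrightarrow> g x + a \<le> g z + c"
  shows "a + \<mu> / 2 * (norm (w - x))\<^sup>2 \<le> b + G \<bullet> (w - x)"
proof -
  define h where "h z = real_of_ereal (\<psi> z)" for z
  have seg: "\<exists>c. \<psi> (x + s *\<^sub>R (w - x)) = ereal c \<and>
      c \<le> (1 - s) * a + s * b - \<mu> / 2 * (s * (1 - s)) * (norm (w - x))\<^sup>2"
    if "0 < s" "s < 1" for s
    using strongly_convex_segment[OF assms(1) x w that] assms(2)[of "x + s *\<^sub>R (w - x)"]
    by (cases "\<psi> (x + s *\<^sub>R (w - x))") auto
  have "h x + \<mu> / 2 * (norm (w - x))\<^sup>2 \<le> h w + G \<bullet> (w - x)"
  proof (rule argmin_quadratic_growth[OF g])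
    fix s :: real assume "0 < s" "s < 1"
    then obtain c where c: "\<psi> (x + s *\<^sub>R (w - x)) = ereal c"
      "c \<le> (1 - s) * a + s * b - \<mu> / 2 * (s * (1 - s)) * (norm (w - x))\<^sup>2"
      using seg by blast
    then show "h (x + s *\<^sub>R (w - x)) \<le> (1 - s) * h x + s * h w - \<mu> / 2 * (s * (1 - s)) * (norm (w - x))\<^sup>2"
      using x w by (simp add: h_def)
    show "g x + h x \<le> g (x + s *\<^sub>R (w - x)) + h (x + s *\<^sub>R (w - x))"
      using c x min by (simp add: h_def)
  qed
  then show ?thesis
    using x w by (simp add: h_def)
qed

section \<open>Existence and contraction of the proximal step\<close>

text \<open>Closedness is known for the epigraph, so the continuous function \<open>\<Phi>\<close>
  is minimized over a sublevel set of the epigraph, which is compact because \<open>\<psi>\<close>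
  is bounded below.\<close>

lemma prox_is_argmin:
  fixes \<psi> :: "'a::euclidean_space \<Rightarrow> ereal"
  assumes closed: "closed_fun \<psi>" and \<eta>: "\<eta> > 0"
    and bound: "\<And>z. ereal m \<le> \<psi> z" and fin: "\<psi> v \<noteq> \<infinity>"
  obtains a where "\<psi> (prox \<eta> \<psi> x) = ereal a"
    and "\<And>z c. \<psi> z = ereal c \<Longrightarrow>
      \<eta> * a + 1 / 2 * (norm (prox \<eta> \<psi> x - x))\<^sup>2 \<le> \<eta> * c + 1 / 2 * (norm (z - x))\<^sup>2"
proof -
  define F where "F z = ereal \<eta> * \<psi> z + ereal (1 / 2 * (norm (z - x))\<^sup>2)" for z
  define \<Phi> where "\<Phi> = (\<lambda>(z, r). \<eta> * r + 1 / 2 * (norm (z - x))\<^sup>2)"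
  obtain b where b: "\<psi> v = ereal b"
    using fin bound[of v] by (cases "\<psi> v") auto
  define M where "M = \<eta> * b + 1 / 2 * (norm (v - x))\<^sup>2"
  define K where "K = {y \<in> ereal_epigraph \<psi>. \<Phi> y \<le> M}"
  have cont: "continuous_on S \<Phi>" for S
    unfolding \<Phi>_def case_prod_beta by (intro continuous_intros)
  have "compact K"
  proof -
    have "K = ereal_epigraph \<psi> \<inter> \<Phi> -` {..M}"
      by (auto simp: K_def)
    moreover have "closed (\<Phi> -` {..M})"
      using cont[of UNIV] closed_atMost by (intro continuous_closed_vimage)
        (auto simp only: continuous_on_eq_continuous_at open_UNIV)
    ultimately have "closed K"
      using closed by (simp add: closed_fun_def closed_Int)
    \<comment> \<open>The lower bound \<open>m \<le> r\<close> limits the distance to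
      \<open>x\<close>; nonnegativity of the square limits \<open>r\<close> from above.\<close>
    have "K \<subseteq> cball x (sqrt (2 * (M - \<eta> * m))) \<times> {m..M / \<eta>}"
    proof
      fix y assume y: "y \<in> K"
      obtain z r where zr: "y = (z, r)"
        by fastforce
      have le: "\<psi> z \<le> ereal r" "\<eta> * r + 1 / 2 * (norm (z - x))\<^sup>2 \<le> M"
        using y by (auto simp: K_def ereal_epigraph_def \<Phi>_def zr)
      have m: "m \<le> r"
        using order_trans[OF bound le(1)] by simp
      then have "\<eta> * m \<le> \<eta> * r"
        using \<eta> by simp
      with le have "(norm (z - x))\<^sup>2 \<le> 2 * (M - \<eta> * m)"
        by simp
      then have "norm (z - x) \<le> sqrt (2 * (M - \<eta> * m))"
        by (rule real_le_rsqrt)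
      moreover have "\<eta> * r \<le> M"
        using le(2) zero_le_power2[of "norm (z - x)"] by linarith
      ultimately show "y \<in> cball x (sqrt (2 * (M - \<eta> * m))) \<times> {m..M / \<eta>}"
        using m \<eta> by (simp add: zr dist_norm norm_minus_commute field_simps)
    qed
    then have "bounded K"
      by (rule bounded_subset[rotated]) (intro bounded_Times bounded_cball bounded_closed_interval)
    with \<open>closed K\<close> show ?thesis
      by (simp add: compact_eq_bounded_closed)
  qed
  moreover have "(v, b) \<in> K"
    using b by (simp add: K_def ereal_epigraph_def \<Phi>_def M_def)
  ultimately obtain y where "y \<in> K" "\<forall>y'\<in>K. \<Phi> y \<le> \<Phi> y'"
    using continuous_attains_inf[of K \<Phi>] cont by blast
  then obtain u r where ur: "(u, r) \<in> K" "\<And>y'. y' \<in> K \<Longrightarrow> \<Phi> (u, r) \<le> \<Phi> y'"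
    by (cases y) blast
  \<comment> \<open>Outside \<open>K\<close> the value of \<open>\<Phi>\<close> exceeds
    \<open>M\<close>, hence also the minimum over \<open>K\<close>.\<close>
  have epi_min: "\<Phi> (u, r) \<le> \<Phi> y'" if "y' \<in> ereal_epigraph \<psi>" for y'
    using ur that by (cases "\<Phi> y' \<le> M") (auto simp: K_def)
  have F_fin: "F z = ereal (\<Phi> (z, c))" if "\<psi> z = ereal c" for z c
    using that by (simp add: F_def \<Phi>_def)
  obtain a where a: "\<psi> u = ereal a" "a \<le> r"
    using ur(1) bound[of u] by (cases "\<psi> u") (auto simp: K_def ereal_epigraph_def)
  have "F u \<le> F z" for z
  proof (cases "\<psi> z")
    case (real c)
    \<comment> \<open>Lowering the height \<open>r\<close> to the value \<open>a\<close> of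
      \<open>\<psi>\<close> at \<open>u\<close> does not increase \<open>\<Phi>\<close>.\<close>
    have "\<Phi> (u, a) \<le> \<Phi> (u, r)"
      using a \<eta> by (simp add: \<Phi>_def)
    also have "\<dots> \<le> \<Phi> (z, c)"
      using real by (intro epi_min) (simp add: ereal_epigraph_def)
    finally show ?thesis
      using F_fin real a by simp
  next
    case PInf
    then show ?thesis
      using \<eta> by (simp add: F_def)
  next
    case MInf
    then show ?thesis
      using bound[of z] by simp
  qed
  then have "is_arg_min F (\<lambda>_. True) u"
    by (simp add: is_arg_min_linorder)
  \<comment> \<open>\<open>arg_min\<close> is a choice operator, so exhibiting one minimizer makes
    the chosen point a minimizer.\<close>
  then have "is_arg_min F (\<lambda>_. True) (arg_min F (\<lambda>_. True))"
    unfolding arg_min_def by (rule someI)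
  then have min: "F (prox \<eta> \<psi> x) \<le> F z" for z
    by (simp add: prox_def F_def[abs_def] is_arg_min_linorder)
  have "F (prox \<eta> \<psi> x) \<noteq> \<infinity>"
    using min[of v] F_fin[OF b] by auto
  then have "\<psi> (prox \<eta> \<psi> x) \<noteq> \<infinity>"
    using \<eta> by (auto simp: F_def)
  then obtain a' where a': "\<psi> (prox \<eta> \<psi> x) = ereal a'"
    using bound[of "prox \<eta> \<psi> x"] by (cases "\<psi> (prox \<eta> \<psi> x)") auto
  show ?thesis
  proof (rule that[OF a'])
    fix z c assume "\<psi> z = ereal c"
    then show "\<eta> * a' + 1 / 2 * (norm (prox \<eta> \<psi> x - x))\<^sup>2 \<le> \<eta> * c + 1 / 2 * (norm (z - x))\<^sup>2"
      using min[of z] F_fin[OF a'] F_fin[of z c] by (simp add: \<Phi>_def)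
  qed
qed

text \<open>The hypothesis \<open>growth\<close> is the optimality condition of a minimizer \<open>v\<close> of \<open>\<psi>\<close> plus a
  differentiable function with gradient \<open>G\<close> at \<open>v\<close>; it says \<open>v = prox \<eta> \<psi> (v - \<eta> *\<^sub>R G)\<close>.\<close>

lemma prox_contraction:
  fixes \<psi> :: "'a::euclidean_space \<Rightarrow> ereal"
  assumes closed: "closed_fun \<psi>" and sc: "strongly_convex \<mu> \<psi>" and MInf: "\<And>z. \<psi> z \<noteq> -\<infinity>"
    and \<mu>: "\<mu> > 0" and \<eta>: "\<eta> > 0" and v: "\<psi> v = ereal b"
    and growth: "\<And>w c. \<psi> w = ereal c \<Longrightarrow> b + \<mu> / 2 * (norm (w - v))\<^sup>2 \<le> c + G \<bullet> (w - v)"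
  shows "(1 + 2 * \<eta> * \<mu>) * (norm (prox \<eta> \<psi> x - v))\<^sup>2 \<le> (norm (x - (v - \<eta> *\<^sub>R G)))\<^sup>2"
proof -
  define u where "u = prox \<eta> \<psi> x"
  \<comment> \<open>The minimum over \<open>t\<close> of
    \<open>b + \<mu> / 2 * t\<^sup>2 - norm G * t\<close>, which by \<open>growth\<close> and
    Cauchy-Schwarz bounds \<open>\<psi>\<close> from below at distance \<open>t\<close> from
    \<open>v\<close>.\<close>
  define m where "m = b - (norm G)\<^sup>2 / (2 * \<mu>)"
  have bound: "ereal m \<le> \<psi> z" for z
  proof (cases "\<psi> z")
    case (real c)
    have "0 \<le> (\<mu> * norm (z - v) - norm G)\<^sup>2 / (2 * \<mu>)"
      using \<mu> by simp
    also have "\<dots> = \<mu> / 2 * (norm (z - v))\<^sup>2 - norm G * norm (z - v) + (norm G)\<^sup>2 / (2 * \<mu>)"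
      using \<mu> by (simp add: power2_eq_square field_simps)
    finally have "m \<le> c"
      using growth[OF real] norm_cauchy_schwarz[of G "z - v"] by (simp add: m_def)
    with real show ?thesis
      by simp
  qed (use MInf in auto)
  obtain a where a: "\<psi> u = ereal a"
    and min: "\<And>z c. \<psi> z = ereal c \<Longrightarrow>
      \<eta> * a + 1 / 2 * (norm (u - x))\<^sup>2 \<le> \<eta> * c + 1 / 2 * (norm (z - x))\<^sup>2"
    using prox_is_argmin[OF closed \<eta> bound, of v x] v unfolding u_def by auto
  \<comment> \<open>The proximal objective is divided by \<open>\<eta>\<close>, so that
    \<open>\<psi>\<close> enters with coefficient 1.\<close>
  have "a + \<mu> / 2 * (norm (v - u))\<^sup>2 \<le> b + ((1 / \<eta>) *\<^sub>R (u - x)) \<bullet> (v - u)"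
  proof (rule strongly_convex_argmin_growth[OF sc MInf _ a v])
    show "GDERIV (\<lambda>z. 1 / (2 * \<eta>) * (norm (z - x))\<^sup>2) u :> (1 / \<eta>) *\<^sub>R (u - x)"
    proof -
      have "((\<lambda>z. 1 / (2 * \<eta>) * ((z - x) \<bullet> (z - x))) has_derivative
          (\<lambda>h. 1 / (2 * \<eta>) * ((u - x) \<bullet> h + h \<bullet> (u - x)))) (at u)"
        by (intro has_derivative_mult_right has_derivative_inner)
          (auto intro!: derivative_eq_intros)
      moreover have "(\<lambda>h. 1 / (2 * \<eta>) * ((u - x) \<bullet> h + h \<bullet> (u - x))) = (\<lambda>h. h \<bullet> ((1 / \<eta>) *\<^sub>R (u - x)))"
        by (rule ext) (simp add: inner_commute)
      ultimately show ?thesis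
        unfolding gderiv_def power2_norm_eq_inner by simp
    qed
    show "1 / (2 * \<eta>) * (norm (u - x))\<^sup>2 + a \<le> 1 / (2 * \<eta>) * (norm (z - x))\<^sup>2 + c"
      if "\<psi> z = ereal c" for z c
    proof -
      have scale: "1 / (2 * \<eta>) * (norm (y - x))\<^sup>2 + d = (\<eta> * d + 1 / 2 * (norm (y - x))\<^sup>2) / \<eta>" for y d
        using \<eta> by (simp add: field_simps)
      show ?thesis
        unfolding scale using min[OF that] \<eta> by (intro divide_right_mono) auto
    qed
  qed
  moreover have "b + \<mu> / 2 * (norm (v - u))\<^sup>2 \<le> a + G \<bullet> (u - v)"
    using growth[OF a] by (simp add: norm_minus_commute)
  \<comment> \<open>Adding the growth inequalities at \<open>u\<close> and at \<open>v\<close>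
    cancels \<open>a\<close> and \<open>b\<close> and doubles the quadratic term.\<close>
  ultimately have "\<mu> * (norm (u - v))\<^sup>2 \<le> ((1 / \<eta>) *\<^sub>R (u - x)) \<bullet> (v - u) + G \<bullet> (u - v)"
    by (simp add: norm_minus_commute)
  then have "\<eta> * (\<mu> * (norm (u - v))\<^sup>2) \<le> \<eta> * (((1 / \<eta>) *\<^sub>R (u - x)) \<bullet> (v - u) + G \<bullet> (u - v))"
    using \<eta> by simp
  then have "(1 + \<eta> * \<mu>) * (norm (u - v))\<^sup>2 \<le> (x - (v - \<eta> *\<^sub>R G)) \<bullet> (u - v)"
    using \<eta> by (simp add: power2_norm_eq_inner algebra_simps inner_commute)
  also have "\<dots> \<le> norm (x - (v - \<eta> *\<^sub>R G)) * norm (u - v)"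
    by (rule norm_cauchy_schwarz)
  finally have "(1 + \<eta> * \<mu>) * norm (u - v) \<le> norm (x - (v - \<eta> *\<^sub>R G))"
    by (cases "u = v") (auto simp: power2_eq_square)
  then have "((1 + \<eta> * \<mu>) * norm (u - v))\<^sup>2 \<le> (norm (x - (v - \<eta> *\<^sub>R G)))\<^sup>2"
    using \<mu> \<eta> by (intro power_mono) auto
  \<comment> \<open>Dropping \<open>(\<eta> * \<mu>)\<^sup>2\<close> from the expanded square gives
    the contraction factor.\<close>
  moreover have "(1 + 2 * \<eta> * \<mu>) * (norm (u - v))\<^sup>2 \<le> (1 + \<eta> * \<mu>)\<^sup>2 * (norm (u - v))\<^sup>2"
    using \<mu> \<eta> by (intro mult_right_mono) (auto simp: power2_eq_square algebra_simps)
  ultimately show ?thesis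
    by (simp add: u_def power_mult_distrib)
qed

section \<open>Random permutations\<close>

lemma set_pmf_random_perm: "set_pmf (random_perm n) = permutations_of_set {1..n}"
  unfolding random_perm_def by (rule set_pmf_of_set) auto

lemma
  assumes "p \<in> permutations_of_set {1..n}"
  shows length_perm: "length p = n"
    and nth_perm: "i < n \<Longrightarrow> p ! i \<in> {1..n}"
proof -
  show len: "length p = n"
    using length_finite_permutations_of_set[OF assms] by simp
  show "p ! i \<in> {1..n}" if "i < n"
    using permutations_of_setD(1)[OF assms] nth_mem[of i p] len that by simp
qed

lemma star_iterate_full:
  assumes "p \<in> permutations_of_set {1..n}"
  shows "star_iterate \<gamma> f p x n = x - \<gamma> *\<^sub>R (\<Sum>i=1..n. gradient (f i) x)"
proof -
  have "bij_betw ((!) p) {..<n} {1..n}"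
    using permutations_of_setD[OF assms] length_perm[OF assms] by (intro bij_betw_nth) auto
  then show ?thesis
    unfolding star_iterate_def
    by (simp add: sum.reindex_bij_betw[where g = "\<lambda>i. gradient (f i) x"])
qed

section \<open>Recursion over the epochs and the shuffling radius\<close>

text \<open>\<open>M\<close> is a joint law of the permutations of all epochs, so both sampling
  schemes are instances. \<open>B\<close> is the fixed point of the recursion that maps
  \<open>y\<close> to \<open>(y + c * B) / (1 + c)\<close>, so the error does not accumulate with
  \<open>T\<close>.\<close>

lemma expectation_shuffled_prox_le:
  fixes f :: "nat \<Rightarrow> 'a::real_inner \<Rightarrow> real" and M :: "(nat \<Rightarrow> nat list) pmf"
  assumes fin: "finite (set_pmf M)"
    and marginal: "\<And>t. t < T \<Longrightarrow> map_pmf (\<lambda>\<pi>. \<pi> t) M = random_perm n"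
    and step: "\<And>x p. p \<in> permutations_of_set {1..n} \<Longrightarrow>
      (1 + c) * (norm (prox (\<gamma> * real n) \<psi> (inner_iterate \<gamma> f p x n) - x\<^sub>s))\<^sup>2 \<le> (norm (x - x\<^sub>s))\<^sup>2 + e p"
    and noise: "measure_pmf.expectation (random_perm n) e \<le> c * B"
    and c: "c > 0" and B: "B \<ge> 0"
  shows "measure_pmf.expectation M (\<lambda>\<pi>. (norm (shuffled_prox_iterate (\<lambda>_. \<gamma>) n f \<psi> \<pi> x\<^sub>0 T - x\<^sub>s))\<^sup>2)
    \<le> (1 + c) powi (- int T) * (norm (x\<^sub>0 - x\<^sub>s))\<^sup>2 + B"
proof -
  define a where "a t \<pi> = (norm (shuffled_prox_iterate (\<lambda>_. \<gamma>) n f \<psi> \<pi> x\<^sub>0 t - x\<^sub>s))\<^sup>2" for t \<pi>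
  define E where "E g = measure_pmf.expectation M g" for g :: "_ \<Rightarrow> real"
  have integrable: "integrable M g" for g :: "_ \<Rightarrow> real"
    using fin by (rule integrable_measure_pmf_finite)
  have "E (a t) \<le> inverse (1 + c) ^ t * (norm (x\<^sub>0 - x\<^sub>s))\<^sup>2 + B" if "t \<le> T" for t
    using that
  proof (induction t)
    case 0
    then show ?case
      using B by (simp add: E_def a_def)
  next
    case (Suc t)
    have perm: "\<pi> t \<in> permutations_of_set {1..n}" if "\<pi> \<in> set_pmf M" for \<pi>
    proof -
      have "\<pi> t \<in> set_pmf (map_pmf (\<lambda>\<pi>. \<pi> t) M)"
        using that by simp
      then show ?thesis
        using Suc.prems by (simp add: marginal set_pmf_random_perm)
    qed
    have "E (\<lambda>\<pi>. e (\<pi> t)) = measure_pmf.expectation (map_pmf (\<lambda>\<pi>. \<pi> t) M) e"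
      by (simp add: E_def)
    also have "\<dots> = measure_pmf.expectation (random_perm n) e"
      using Suc.prems by (simp add: marginal)
    finally have Ee: "E (\<lambda>\<pi>. e (\<pi> t)) \<le> c * B"
      using noise by simp
    have "(1 + c) * E (a (Suc t)) = E (\<lambda>\<pi>. (1 + c) * a (Suc t) \<pi>)"
      by (simp add: E_def)
    also have "\<dots> \<le> E (\<lambda>\<pi>. a t \<pi> + e (\<pi> t))"
      unfolding E_def using step perm
      by (intro integral_mono_AE integrable AE_pmfI) (simp add: a_def)
    also have "\<dots> = E (a t) + E (\<lambda>\<pi>. e (\<pi> t))"
      unfolding E_def by (intro Bochner_Integration.integral_add integrable)
    also have "\<dots> \<le> inverse (1 + c) ^ t * (norm (x\<^sub>0 - x\<^sub>s))\<^sup>2 + B + c * B"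
      using Suc Ee by simp
    also have "\<dots> = (1 + c) * (inverse (1 + c) ^ Suc t * (norm (x\<^sub>0 - x\<^sub>s))\<^sup>2 + B)"
    proof -
      have "(1 + c) * (inverse (1 + c) * y) = y" for y
        using c by simp
      then show ?thesis
        by (simp only: distrib_left[of "1 + c"] power_Suc mult.assoc)
          (simp only: distrib_right mult_1 add.assoc)
    qed
    finally show ?case
      using c by (simp only: mult_le_cancel_left_pos add_pos_pos zero_less_one)
  qed
  from this[of T] show ?thesis
    by (simp add: E_def a_def[abs_def] power_int_minus power_inverse)
qed

lemma
  fixes f :: "nat \<Rightarrow> 'a::real_inner \<Rightarrow> real"
  assumes nonneg: "\<And>i z. i \<in> {1..n} \<Longrightarrow> 0 \<le> bregman (f i) z x\<^sub>s"
    and \<gamma>: "\<gamma> > 0"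
  shows shuffling_radius_sq_nonneg: "0 \<le> shuffling_radius_sq n f x\<^sub>s \<gamma>"
    and expectation_bregman_star_iterate_le:
      "measure_pmf.expectation (random_perm n) (\<lambda>p. \<Sum>j<n. bregman (f (p ! j)) (star_iterate \<gamma> f p x\<^sub>s j) x\<^sub>s)
        \<le> real n * (\<gamma>\<^sup>2 * shuffling_radius_sq n f x\<^sub>s \<gamma>)"
proof -
  define \<sigma> where "\<sigma> = shuffling_radius_sq n f x\<^sub>s \<gamma>"
  define b where "b i = measure_pmf.expectation (random_perm n)
    (\<lambda>p. bregman (f (p ! i)) (star_iterate \<gamma> f p x\<^sub>s i) x\<^sub>s)" for i
  have b_nonneg: "0 \<le> b i" if "i < n" for i
    unfolding b_def using nonneg nth_perm that
    by (intro integral_nonneg_AE AE_pmfI) (auto simp: set_pmf_random_perm)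
  have le: "1 / \<gamma>\<^sup>2 * b i \<le> \<sigma>" if "i \<in> {1..n - 1}" for i
    using that unfolding \<sigma>_def shuffling_radius_sq_def b_def by (auto intro!: Max_ge)
  show \<sigma>: "0 \<le> shuffling_radius_sq n f x\<^sub>s \<gamma>"
  proof (cases "n \<le> 1")
    case False
    \<comment> \<open>For \<open>n > 1\<close> the maximum dominates its entry at 1, an average of
      nonnegative divergences.\<close>
    then have "0 \<le> 1 / \<gamma>\<^sup>2 * b 1"
      using b_nonneg[of 1] by simp
    also have "\<dots> \<le> \<sigma>"
      using False by (intro le) auto
    finally show ?thesis
      by (simp add: \<sigma>_def)
  qed (simp add: shuffling_radius_sq_def)
  have b_le: "b i \<le> \<gamma>\<^sup>2 * \<sigma>" if "i < n" for i
  \<comment> \<open>The sum starts at 0 but the maximum at 1: reference point 0 is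
    \<open>x\<^sub>s\<close> itself, with zero divergence.\<close>
  proof (cases "i = 0")
    case True
    then show ?thesis
      using \<sigma> by (simp add: b_def bregman_def star_iterate_def \<sigma>_def)
  next
    case False
    with le[of i] that \<gamma> show ?thesis
      by (simp add: field_simps)
  qed
  have "measure_pmf.expectation (random_perm n) (\<lambda>p. \<Sum>j<n. bregman (f (p ! j)) (star_iterate \<gamma> f p x\<^sub>s j) x\<^sub>s)
      = (\<Sum>j<n. b j)"
    unfolding b_def by (intro Bochner_Integration.integral_sum integrable_measure_pmf_finite)
      (simp add: set_pmf_random_perm)
  also have "\<dots> \<le> real n * (\<gamma>\<^sup>2 * \<sigma>)"
    using sum_bounded_above[of "{..<n}" b "\<gamma>\<^sup>2 * \<sigma>"] b_le by simp
  finally show "measure_pmf.expectation (random_perm n) (\<lambda>p. \<Sum>j<n. bregman (f (p ! j)) (star_iterate \<gamma> f p x\<^sub>s j) x\<^sub>s)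
        \<le> real n * (\<gamma>\<^sup>2 * shuffling_radius_sq n f x\<^sub>s \<gamma>)"
    by (simp add: \<sigma>_def)
qed

section \<open>Convergence of both sampling schemes\<close>

theorem theorem4:
  fixes f :: "nat \<Rightarrow> real ^ 'd \<Rightarrow> real"
    and \<psi> :: "real ^ 'd \<Rightarrow> ereal"
    and L :: "nat \<Rightarrow> real"
    and \<mu> \<gamma> :: real
    and n T :: nat
    and x\<^sub>0 x\<^sub>s :: "real ^ 'd"
  assumes "n \<ge> 1"
    and "\<And>i. i \<in> {1..n} \<Longrightarrow> convex_on UNIV (f i)"
    and "\<And>i. i \<in> {1..n} \<Longrightarrow> L i > 0"
    and "\<And>i. i \<in> {1..n} \<Longrightarrow> L_smooth (L i) (f i)"
    and "\<mu> > 0"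
    and "proper_fun \<psi>"
    and "closed_fun \<psi>"
    and "strongly_convex \<mu> \<psi>"
    and "is_arg_min (composite_objective n f \<psi>) (\<lambda>_. True) x\<^sub>s"
    and "0 < \<gamma>"
    and "\<gamma> \<le> 1 / Max (L ` {1..n})"
  shows "measure_pmf.expectation (prox_rr (\<lambda>_. \<gamma>) n f \<psi> x\<^sub>0 T) (\<lambda>x. (norm (x - x\<^sub>s))\<^sup>2)
           \<le> (1 + 2 * \<gamma> * \<mu> * real n) powi (- int T) * (norm (x\<^sub>0 - x\<^sub>s))\<^sup>2
              + \<gamma>\<^sup>2 * shuffling_radius_sq n f x\<^sub>s \<gamma> / \<mu> \<and>
         measure_pmf.expectation (prox_so (\<lambda>_. \<gamma>) n f \<psi> x\<^sub>0 T) (\<lambda>x. (norm (x - x\<^sub>s))\<^sup>2)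
           \<le> (1 + 2 * \<gamma> * \<mu> * real n) powi (- int T) * (norm (x\<^sub>0 - x\<^sub>s))\<^sup>2
              + \<gamma>\<^sup>2 * shuffling_radius_sq n f x\<^sub>s \<gamma> / \<mu>"
proof -
  define \<sigma> where "\<sigma> = shuffling_radius_sq n f x\<^sub>s \<gamma>"
  define e where "e p = 2 * \<gamma> * (\<Sum>j<n. bregman (f (p ! j)) (star_iterate \<gamma> f p x\<^sub>s j) x\<^sub>s)" for p
  define G where "G = (1 / real n) *\<^sub>R (\<Sum>i=1..n. gradient (f i) x\<^sub>s)"
  have diff: "f i differentiable (at z)" if "i \<in> {1..n}" for i z
    using assms(4)[OF that] by (simp add: L_smooth_def)
  have nonneg: "0 \<le> bregman (f i) z x\<^sub>s" if "i \<in> {1..n}" for i z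
    using assms(2) diff that by (intro bregman_nonneg) auto
  have MInf: "\<psi> z \<noteq> -\<infinity>" for z
    using assms(6) by (simp add: proper_fun_def)
  have min: "composite_objective n f \<psi> x\<^sub>s \<le> composite_objective n f \<psi> z" for z
    using assms(9) by (simp add: is_arg_min_linorder)
  obtain v where "\<psi> v \<noteq> \<infinity>"
    using assms(6) by (auto simp: proper_fun_def)
  \<comment> \<open>The objective is finite at \<open>v\<close>, so its minimal value is finite and
    \<open>\<psi>\<close> is finite at \<open>x\<^sub>s\<close>.\<close>
  with min[of v] obtain b where b: "\<psi> x\<^sub>s = ereal b"
    using MInf[of x\<^sub>s] by (cases "\<psi> x\<^sub>s") (auto simp: composite_objective_def)
  have "GDERIV (\<lambda>z. 1 / real n * (\<Sum>i=1..n. f i z)) x\<^sub>s :> G"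
  proof -
    have "((\<lambda>z. 1 / real n * (\<Sum>i=1..n. f i z)) has_derivative
        (\<lambda>h. 1 / real n * (\<Sum>i=1..n. h \<bullet> gradient (f i) x\<^sub>s))) (at x\<^sub>s)"
      using gderiv_gradient[OF diff] unfolding gderiv_def
      by (intro has_derivative_mult_right has_derivative_sum) auto
    then show ?thesis
      by (simp add: gderiv_def G_def inner_sum_right)
  qed
  then have growth: "b + \<mu> / 2 * (norm (w - x\<^sub>s))\<^sup>2 \<le> c + G \<bullet> (w - x\<^sub>s)" if "\<psi> w = ereal c" for w c
  proof (rule strongly_convex_argmin_growth[OF assms(8) MInf _ b that])
    show "1 / real n * (\<Sum>i=1..n. f i x\<^sub>s) + b \<le> 1 / real n * (\<Sum>i=1..n. f i z) + c"
      if "\<psi> z = ereal c" for z c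
      using min[of z] that b by (simp add: composite_objective_def)
  qed
  have \<gamma>L: "\<gamma> * L i \<le> 1" if "i \<in> {1..n}" for i
  proof -
    have "L i \<le> Max (L ` {1..n})"
      using that by simp
    then have "\<gamma> * L i \<le> \<gamma> * Max (L ` {1..n})"
      using assms(10) by simp
    also have "\<dots> \<le> 1"
      using assms(11) assms(3)[OF that] \<open>L i \<le> _\<close> by (simp add: field_simps)
    finally show ?thesis .
  qed
  have step: "(1 + 2 * \<gamma> * \<mu> * real n) * (norm (prox (\<gamma> * real n) \<psi> (inner_iterate \<gamma> f p x n) - x\<^sub>s))\<^sup>2
      \<le> (norm (x - x\<^sub>s))\<^sup>2 + e p" if p: "p \<in> permutations_of_set {1..n}" for x p
  proof -
    \<comment> \<open>With \<open>\<eta> = \<gamma> * real n\<close> this is the point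
      \<open>v - \<eta> *\<^sub>R G\<close> of the contraction lemma.\<close>
    have "star_iterate \<gamma> f p x\<^sub>s n = x\<^sub>s - (\<gamma> * real n) *\<^sub>R G"
      using star_iterate_full[OF p] assms(1) by (simp add: G_def)
    then have "(1 + 2 * (\<gamma> * real n) * \<mu>) * (norm (prox (\<gamma> * real n) \<psi> (inner_iterate \<gamma> f p x n) - x\<^sub>s))\<^sup>2
        \<le> (norm (inner_iterate \<gamma> f p x n - star_iterate \<gamma> f p x\<^sub>s n))\<^sup>2"
      using assms(1,10) prox_contraction[OF assms(7,8) MInf assms(5) _ b growth, of "\<gamma> * real n"] by simp
    also have "\<dots> \<le> (norm (x - x\<^sub>s))\<^sup>2 + e p"
      unfolding e_def using nth_perm[OF p] assms(2,3,4,10) \<gamma>L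
      by (intro inner_iterate_norm_le[of _ _ _ L]) auto
    finally show ?thesis
      by (simp add: mult_ac)
  qed
  have "measure_pmf.expectation (random_perm n) e \<le> 2 * \<gamma> * (real n * (\<gamma>\<^sup>2 * \<sigma>))"
    unfolding e_def[abs_def] \<sigma>_def
    using expectation_bregman_star_iterate_le[of n f x\<^sub>s \<gamma>] nonneg assms(10) by simp
  \<comment> \<open>Factoring out the contraction constant
    \<open>c = 2 * \<gamma> * \<mu> * real n\<close> identifies \<open>B\<close> as the final error
    term.\<close>
  also have "\<dots> = (2 * \<gamma> * \<mu> * real n) * (\<gamma>\<^sup>2 * \<sigma> / \<mu>)"
    using assms(5) by simp
  finally have noise: "measure_pmf.expectation (random_perm n) e \<le> (2 * \<gamma> * \<mu> * real n) * (\<gamma>\<^sup>2 * \<sigma> / \<mu>)" .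
  have pos: "0 < 2 * \<gamma> * \<mu> * real n" "0 \<le> \<gamma>\<^sup>2 * \<sigma> / \<mu>"
    using assms(1,5,10) shuffling_radius_sq_nonneg[of n f x\<^sub>s \<gamma>] nonneg by (auto simp: \<sigma>_def)
  note bound = expectation_shuffled_prox_le[OF _ _ step noise pos, where T = T]
  have fin: "finite (set_pmf (random_perm n))"
    by (simp add: set_pmf_random_perm)
  have "measure_pmf.expectation (prox_rr (\<lambda>_. \<gamma>) n f \<psi> x\<^sub>0 T) (\<lambda>x. (norm (x - x\<^sub>s))\<^sup>2)
      \<le> (1 + 2 * \<gamma> * \<mu> * real n) powi (- int T) * (norm (x\<^sub>0 - x\<^sub>s))\<^sup>2 + \<gamma>\<^sup>2 * \<sigma> / \<mu>"
    unfolding prox_rr_def integral_map_pmf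
  proof (rule bound)
    show "finite (set_pmf (Pi_pmf {..<T} [] (\<lambda>_. random_perm n)))"
      unfolding set_Pi_pmf[OF finite_lessThan] using fin by (intro finite_PiE_dflt) auto
    \<comment> \<open>Coordinates from \<open>T\<close> on carry the default \<open>[]\<close>; only
      the earlier ones are uniform.\<close>
    show "map_pmf (\<lambda>\<pi>. \<pi> t) (Pi_pmf {..<T} [] (\<lambda>_. random_perm n)) = random_perm n" if "t < T" for t
      using that by (simp add: Pi_pmf_component)
  qed
  \<comment> \<open>A single shuffle is the law of a constant sequence of permutations.\<close>
  moreover have "measure_pmf.expectation (map_pmf (\<lambda>p _. p) (random_perm n))
      (\<lambda>\<pi>. (norm (shuffled_prox_iterate (\<lambda>_. \<gamma>) n f \<psi> \<pi> x\<^sub>0 T - x\<^sub>s))\<^sup>2)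
      \<le> (1 + 2 * \<gamma> * \<mu> * real n) powi (- int T) * (norm (x\<^sub>0 - x\<^sub>s))\<^sup>2 + \<gamma>\<^sup>2 * \<sigma> / \<mu>"
    using fin by (intro bound) (simp_all add: pmf.map_comp o_def)
  ultimately show ?thesis
    by (simp add: prox_so_def \<sigma>_def)
qed

end
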